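(* Let $(\gamma,\eta):I\rightarrow X\times S$ be a Legendre curve with curvature $(\alpha,\kappa)$. If $p\in X\setminus\gamma(I)$, then the pedal curve $\gamma_p$ of $\gamma$ with respect to $p$ is a frontal. Moreover, the singular points of $\gamma_p$ correspond exactly to the points where $\kappa$ vanishes, i.e. for $t\in I$, $\gamma_p'(t)=0$ if and only if $\kappa(t)=0$.
   Context: Let $(X,\|\cdot\|)$ be a two-dimensional real normed space with unit circle $S=\{x\in X:\|x\|=1\}$. The plane is assumed smooth ($S$ is a smooth curve) and strictly convex ($S$ contains no line segment). Fix a nondegenerate symplectic (alternating) bilinear form $[\cdot,\cdot]$ on $X$. For $x,y\in X$, $x\dashv_B y$ (Birkhoff orthogonality) means $\|x+ty\|\ge\|x\|$ for all $t\in\mathbb{R}$. For $v\in X\setminus\{o\}$ let $b(v)\in S$ be the unique vector with $v\dashv_B b(v)$ and $[v,b(v)]>0$. A Legendre curve is a smooth map $(\gamma,\eta):I\rightarrow X\times S$ ($I$ an interval) with $\eta(t)\dashv_B\gamma'(t)$ for all $t\in I$. Put $\xi(t)=b(\eta(t))$. The curvature is the pair of smooth functions $(\alpha,\kappa)$ with $\gamma'(t)=\alpha(t)\xi(t)$ and $\eta'(t)=\kappa(t)\xi(t)$. A curve $\sigma:I\to X$ is a frontal if there is a smooth $\nu:I\to S$ such that $(\sigma,\nu)$ is a Legendre curve. For $p\in X$, the pedal curve $\gamma_p:I\to X$ of $\gamma$ with respect to $p$ assigns to $t$ the unique point $\gamma_p(t)$ of the line $s\mapsto\gamma(t)+s\xi(t)$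 with $\gamma_p(t)-p\dashv_B\xi(t)$, i.e. the intersection of the line through $p$ parallel to $\eta(t)$ with the tangent line $\{\gamma(t)+s\xi(t):s\in\mathbb{R}\}$.
   Formalization: The unit circle S is additionally assumed to have nowhere vanishing curvature, which "S contains no line segment" does not give; without it the claim is false, e.g. in the l_4 plane a pedal curve can be singular where κ is nonzero. *)

theory Defs
  imports "HOL-Analysis.Analysis"
begin

text \<open>
  \<open>C\<^sup>\<infinity>\<close> regularity of a map on a set of parameters; \<open>D n\<close> is the \<open>n\<close>-th derivative.
  At end points belonging to \<open>I\<close> the derivatives are one-sided.
\<close>

definition smooth_on :: "real set \<Rightarrow> (real \<Rightarrow> 'a::real_normed_vector) \<Rightarrow> bool" where
  "smooth_on I f \<longleftrightarrow>
     (\<exists>D :: nat \<Rightarrow> real \<Rightarrow> 'a.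
        (\<forall>t\<in>I. D 0 t = f t) \<and>
        (\<forall>n. \<forall>t\<in>I. (D n has_vector_derivative D (Suc n) t) (at t within I)))"

definition birkhoff_orth :: "'a::real_normed_vector \<Rightarrow> 'a \<Rightarrow> bool"  (infix "\<stileturn>\<^sub>B" 50) where
  "x \<stileturn>\<^sub>B y \<longleftrightarrow> (\<forall>t::real. norm (x + t *\<^sub>R y) \<ge> norm x)"

definition unit_circle_param :: "(real \<Rightarrow> 'a::real_normed_vector) \<Rightarrow> bool" where
  "unit_circle_param \<phi> \<longleftrightarrow>
     smooth_on UNIV \<phi> \<and> range \<phi> = sphere 0 1 \<and> (\<forall>u. vector_derivative \<phi> (at u) \<noteq> 0)"

text \<open>
  A smooth, strictly convex normed plane with a fixed symplectic form. As the unit circle is a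
  one-dimensional topological manifold, the (not necessarily injective) immersion in
  \<open>smooth_circle\<close> exhibits it as a smooth embedded curve.
\<close>

locale normed_plane =
  fixes \<omega> :: "'a::real_normed_vector \<Rightarrow> 'a \<Rightarrow> real"
  assumes dim_2: "dim (UNIV :: 'a set) = 2"
    and bilinear: "bilinear \<omega>"
    and alternating: "\<omega> x x = 0"
    and nondegenerate: "(\<And>y. \<omega> x y = 0) \<Longrightarrow> x = 0"
    and smooth_circle: "\<exists>\<phi> :: real \<Rightarrow> 'a. unit_circle_param \<phi>"
    and strictly_convex: "x \<noteq> y \<Longrightarrow> \<not> closed_segment x y \<subseteq> sphere 0 1"

text \<open>
  The unit circle has no point of zero curvature (\<open>\<phi>'\<close> and \<open>\<phi>''\<close> are linearly independent).
  This is stronger than \<open>strictly_convex\<close>: the curvature of the \<open>\<ell>\<^sub>4\<close> unit circle vanishes at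
  the coordinate axes. It says that the map \<open>b\<close> below restricts to a diffeomorphism of the unit
  circle, rather than merely a smooth homeomorphism. Without it a pedal curve need not be a
  frontal, and can be singular where the curvature \<open>\<kappa>\<close> does not vanish.
\<close>

definition nonflat_unit_circle :: "('a::real_normed_vector \<Rightarrow> 'a \<Rightarrow> real) \<Rightarrow> bool" where
  "nonflat_unit_circle \<omega> \<longleftrightarrow>
     (\<exists>\<phi>. unit_circle_param \<phi> \<and>
       (\<forall>u. \<omega> (vector_derivative \<phi> (at u))
              (vector_derivative (\<lambda>s. vector_derivative \<phi> (at s)) (at u)) \<noteq> 0))"

text \<open>The vector \<open>b(v)\<close>; only meaningful for \<open>v \<noteq> 0\<close>.\<close>

definition birkhoff_vec :: "('a::real_normed_vector \<Rightarrow> 'a \<Rightarrow> real) \<Rightarrow> 'a \<Rightarrow> 'a" where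
  "birkhoff_vec \<omega> v = (THE w. norm w = 1 \<and> v \<stileturn>\<^sub>B w \<and> \<omega> v w > 0)"

definition legendre_curve ::
  "real set \<Rightarrow> (real \<Rightarrow> 'a::real_normed_vector) \<Rightarrow> (real \<Rightarrow> 'a) \<Rightarrow> bool" where
  "legendre_curve I \<gamma> \<eta> \<longleftrightarrow>
     smooth_on I \<gamma> \<and> smooth_on I \<eta> \<and>
     (\<forall>t\<in>I. norm (\<eta> t) = 1 \<and> \<eta> t \<stileturn>\<^sub>B vector_derivative \<gamma> (at t within I))"

definition legendre_curvature ::
  "('a::real_normed_vector \<Rightarrow> 'a \<Rightarrow> real) \<Rightarrow> real set \<Rightarrow> (real \<Rightarrow> 'a) \<Rightarrow> (real \<Rightarrow> 'a)
    \<Rightarrow> (real \<Rightarrow> real) \<Rightarrow> (real \<Rightarrow> real) \<Rightarrow> bool" where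
  "legendre_curvature \<omega> I \<gamma> \<eta> \<alpha> \<kappa> \<longleftrightarrow>
     smooth_on I \<alpha> \<and> smooth_on I \<kappa> \<and>
     (\<forall>t\<in>I. vector_derivative \<gamma> (at t within I) = \<alpha> t *\<^sub>R birkhoff_vec \<omega> (\<eta> t) \<and>
            vector_derivative \<eta> (at t within I) = \<kappa> t *\<^sub>R birkhoff_vec \<omega> (\<eta> t))"

definition frontal :: "real set \<Rightarrow> (real \<Rightarrow> 'a::real_normed_vector) \<Rightarrow> bool" where
  "frontal I \<sigma> \<longleftrightarrow> (\<exists>\<nu>. legendre_curve I \<sigma> \<nu>)"

definition pedal_curve ::
  "('a::real_normed_vector \<Rightarrow> 'a \<Rightarrow> real) \<Rightarrow> (real \<Rightarrow> 'a) \<Rightarrow> (real \<Rightarrow> 'a) \<Rightarrow> 'a \<Rightarrow> real \<Rightarrow> 'a" where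
  "pedal_curve \<omega> \<gamma> \<eta> p t =
     (THE q. (\<exists>s::real. q = \<gamma> t + s *\<^sub>R birkhoff_vec \<omega> (\<eta> t)) \<and>
             q - p \<stileturn>\<^sub>B birkhoff_vec \<omega> (\<eta> t))"

end

theory Submission
  imports Defs
begin

text \<open>
  Let \<open>\<theta>\<close> be a smooth polar angle of \<open>\<eta>\<close>, and let \<open>E\<close> and \<open>T\<close> be the position and the tangent vector of
  the polar parametrization of the unit circle at that angle. Decompose \<open>\<gamma> - p = x E + y T\<close>. The
  pedal curve is \<open>p + x E\<close>, since \<open>E\<close> is Birkhoff orthogonal to the tangent direction \<open>T\<close>. As \<open>\<gamma>'\<close> is
  parallel to \<open>T\<close>, the velocity of the pedal curve has the form \<open>\<theta>' W\<close> with
  \<open>W = x T + c y E\<close>, where \<open>c\<close> is the quotient of the determinants of \<open>(T, T')\<close> and \<open>(E, T)\<close>, with \<open>T'\<close>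
  the derivative of \<open>T\<close> by the angle. Nonflatness of the unit circle means \<open>c \<noteq> 0\<close>, and \<open>p\<close> is not on
  the curve, so \<open>(x, y) \<noteq> (0, 0)\<close> and \<open>W\<close> has no zero. Since \<open>\<theta>'\<close> is a positive multiple of \<open>\<kappa>\<close>, the
  pedal curve is singular exactly where \<open>\<kappa>\<close> vanishes.

  A unit normal of the pedal curve must be Birkhoff orthogonal to the direction \<open>W\<close>, which is smooth
  even across the zeros of \<open>\<kappa>\<close>. Such a normal is found by inverting the tangent angle of the unit
  circle: by nonflatness and periodicity the tangent angle is a diffeomorphism of the real line as a
  function of the polar angle (\<open>tangent_direction_section\<close>), so composing its inverse with a smooth
  angle of \<open>W\<close> gives a smooth normal on the whole interval (\<open>ex_smooth_normal\<close>).

  As angles are defined on the whole interval, no local lifts to the unit circle have to be matched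
  along it. The angles come from logarithms of planar curves, obtained by integrating \<open>z' / z\<close>
  (\<open>smooth_logarithm\<close>). The polar parametrization is smooth because it is the given parametrization of
  the circle composed with the inverse of the polar angle of the latter (\<open>smooth_polar\<close>). Smoothness
  itself is proved by coinduction (\<open>smooth_on_coinduct\<close>).
\<close>

section \<open>Smooth functions on a set of reals\<close>

text \<open>
  A class of functions in which every member has a derivative that is again a member consists of
  smooth functions: iterating the choice of a derivative yields all higher derivatives at once.
  This replaces the formulas of Leibniz and Faa di Bruno for higher derivatives of products and
  compositions.
\<close>
lemma smooth_on_coinduct:
  assumes "P f"
    and step: "\<And>g. P g \<Longrightarrow> \<exists>g'. P g' \<and> (\<forall>t\<in>I. (g has_vector_derivative g' t) (at t within I))"
  shows "smooth_on I f"
proof -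
  obtain d where d: "P (d g)" "\<forall>t\<in>I. (g has_vector_derivative d g t) (at t within I)" if "P g" for g
    using step by metis
  have P: "P ((d ^^ n) f)" for n
    by (induction n) (auto simp: \<open>P f\<close> d(1))
  show ?thesis
    unfolding smooth_on_def using d(2)[OF P] by (intro exI[of _ "\<lambda>n. (d ^^ n) f"]) auto
qed

lemma smooth_onE:
  assumes "smooth_on I f"
  obtains f' where "smooth_on I f'" "\<And>t. t \<in> I \<Longrightarrow> (f has_vector_derivative f' t) (at t within I)"
proof -
  obtain D where D: "\<And>t. t \<in> I \<Longrightarrow> D 0 t = f t"
      "\<And>n t. t \<in> I \<Longrightarrow> (D n has_vector_derivative D (Suc n) t) (at t within I)"
    using assms unfolding smooth_on_def by blast
  have "smooth_on I (D 1)"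
    unfolding smooth_on_def using D by (intro exI[of _ "\<lambda>n. D (Suc n)"]) auto
  moreover have "(f has_vector_derivative D 1 t) (at t within I)" if "t \<in> I" for t
    using has_vector_derivative_transform[OF that _ D(2)[OF that, of 0], of f] D(1) by simp
  ultimately show ?thesis using that by blast
qed

lemma smooth_onI_derivative:
  assumes "smooth_on I f'" "\<And>t. t \<in> I \<Longrightarrow> (f has_vector_derivative f' t) (at t within I)"
  shows "smooth_on I f"
proof (rule smooth_on_coinduct[where P = "\<lambda>g. g = f \<or> smooth_on I g"])
  fix g assume "g = f \<or> smooth_on I g"
  then show "\<exists>g'. (g' = f \<or> smooth_on I g') \<and>
      (\<forall>t\<in>I. (g has_vector_derivative g' t) (at t within I))"
  proof
    assume "g = f"
    with assms show ?thesis by blast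
  next
    assume "smooth_on I g"
    then show ?thesis by (rule smooth_onE) blast
  qed
qed simp

lemma smooth_on_cong:
  assumes "\<And>t. t \<in> I \<Longrightarrow> f t = g t" "smooth_on I f"
  shows "smooth_on I g"
  using assms unfolding smooth_on_def by simp

lemma smooth_on_imp_continuous_on: "smooth_on I f \<Longrightarrow> continuous_on I f"
  by (erule smooth_onE) (rule continuous_on_vector_derivative)

lemma smooth_on_bounded_linear:
  assumes "bounded_linear h" "smooth_on I f"
  shows "smooth_on I (\<lambda>t. h (f t))"
proof -
  obtain D where "\<forall>t\<in>I. D 0 t = f t"
      "\<forall>n. \<forall>t\<in>I. (D n has_vector_derivative D (Suc n) t) (at t within I)"
    using assms(2) unfolding smooth_on_def by blast
  then show ?thesis
    unfolding smooth_on_def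
    by (intro exI[of _ "\<lambda>n t. h (D n t)"])
       (auto intro: bounded_linear.has_vector_derivative[OF assms(1)])
qed

lemma smooth_on_const: "smooth_on I (\<lambda>_. c)"
  by (rule smooth_on_coinduct[where P = "\<lambda>g. \<exists>c. g = (\<lambda>_. c)"])
     (auto intro!: exI[of _ "\<lambda>_. 0"] has_vector_derivative_const)

lemma smooth_on_ident: "smooth_on I (\<lambda>t. t)"
  by (rule smooth_onI_derivative[where f' = "\<lambda>_. 1"]) (auto intro: smooth_on_const)

text \<open>
  The closure of the smooth functions under the usual operations. The rules of calculus express the
  derivative of such an expression by another one, so by coinduction the closure adds nothing new.
\<close>
inductive smooth_expr :: "real set \<Rightarrow> (real \<Rightarrow> 'a::{real_normed_field,banach}) \<Rightarrow> bool" where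
  base: "smooth_on I f \<Longrightarrow> smooth_expr I f"
| add: "smooth_expr I f \<Longrightarrow> smooth_expr I g \<Longrightarrow> smooth_expr I (\<lambda>t. f t + g t)"
| mult: "smooth_expr I f \<Longrightarrow> smooth_expr I g \<Longrightarrow> smooth_expr I (\<lambda>t. f t * g t)"
| inverse: "smooth_expr I f \<Longrightarrow> (\<And>t. t \<in> I \<Longrightarrow> f t \<noteq> 0) \<Longrightarrow> smooth_expr I (\<lambda>t. inverse (f t))"
| comp: "smooth_expr J f \<Longrightarrow> smooth_on I h \<Longrightarrow> h ` I \<subseteq> J \<Longrightarrow> smooth_expr I (\<lambda>t. f (h t))"

lemma smooth_expr_derivative:
  assumes "smooth_expr I f"
  shows "\<exists>f'. smooth_expr I f' \<and> (\<forall>t\<in>I. (f has_vector_derivative f' t) (at t within I))"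
  using assms
proof induction
  case (base I f)
  then show ?case by (metis smooth_onE smooth_expr.base)
next
  case (add I f g)
  then obtain f' g' where "smooth_expr I f'" "smooth_expr I g'"
      "\<forall>t\<in>I. (f has_vector_derivative f' t) (at t within I)"
      "\<forall>t\<in>I. (g has_vector_derivative g' t) (at t within I)" by blast
  then show ?case
    by (intro exI[of _ "\<lambda>t. f' t + g' t"])
       (auto intro: smooth_expr.add has_vector_derivative_add)
next
  case (mult I f g)
  then obtain f' g' where "smooth_expr I f'" "smooth_expr I g'"
      "\<forall>t\<in>I. (f has_vector_derivative f' t) (at t within I)"
      "\<forall>t\<in>I. (g has_vector_derivative g' t) (at t within I)" by blast
  with mult.hyps show ?case
    by (intro exI[of _ "\<lambda>t. f t * g' t + f' t * g t"])
       (auto intro: smooth_expr.intros has_vector_derivative_mult)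
next
  case (inverse I f)
  then obtain f' where f': "smooth_expr I f'"
      "\<forall>t\<in>I. (f has_vector_derivative f' t) (at t within I)" by blast
  have "((\<lambda>t. inverse (f t)) has_vector_derivative - 1 * (inverse (f t) * f' t * inverse (f t)))
      (at t within I)" if "t \<in> I" for t
    using field_vector_diff_chain_within[OF bspec[OF f'(2) that] DERIV_inverse'[OF DERIV_ident]]
      inverse.hyps that by (simp add: o_def mult.commute mult.left_commute)
  moreover have "smooth_expr I (\<lambda>t. - 1 * (inverse (f t) * f' t * inverse (f t)))"
    by (intro smooth_expr.mult smooth_expr.inverse inverse.hyps f' smooth_expr.base smooth_on_const)
  ultimately show ?case by blast
next
  case (comp J f I h)
  then obtain f' where f': "smooth_expr J f'"
      "\<forall>t\<in>J. (f has_vector_derivative f' t) (at t within J)" by blast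
  obtain h' where h': "smooth_on I h'"
      "\<And>t. t \<in> I \<Longrightarrow> (h has_vector_derivative h' t) (at t within I)"
    using comp.hyps(2) smooth_onE by blast
  have "((\<lambda>t. f (h t)) has_vector_derivative of_real (h' t) * f' (h t)) (at t within I)"
    if "t \<in> I" for t
  proof -
    have "(f has_vector_derivative f' (h t)) (at (h t) within h ` I)"
      using f'(2) comp.hyps(3) that has_vector_derivative_within_subset by blast
    from vector_diff_chain_within[OF h'(2)[OF that] this]
    show ?thesis by (simp add: o_def scaleR_conv_of_real)
  qed
  moreover have "smooth_expr I (\<lambda>t. of_real (h' t) * f' (h t))"
    by (intro smooth_expr.mult smooth_expr.base
        smooth_on_bounded_linear[OF bounded_linear_of_real h'(1)] smooth_expr.comp[OF f'(1)] comp.hyps)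
  ultimately show ?case by blast
qed

lemma smooth_expr_iff_smooth_on: "smooth_expr I f \<longleftrightarrow> smooth_on I f"
proof
  show "smooth_on I f" if "smooth_expr I f"
    using that by (rule smooth_on_coinduct) (rule smooth_expr_derivative)
qed (rule smooth_expr.base)

lemmas smooth_on_add = smooth_expr.add[unfolded smooth_expr_iff_smooth_on]
  and smooth_on_mult = smooth_expr.mult[unfolded smooth_expr_iff_smooth_on]
  and smooth_on_inverse = smooth_expr.inverse[unfolded smooth_expr_iff_smooth_on]
  and smooth_on_compose = smooth_expr.comp[unfolded smooth_expr_iff_smooth_on]

lemma smooth_on_divide:
  fixes f g :: "real \<Rightarrow> 'a::{real_normed_field,banach}"
  assumes "smooth_on I f" "smooth_on I g" "\<And>t. t \<in> I \<Longrightarrow> g t \<noteq> 0"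
  shows "smooth_on I (\<lambda>t. f t / g t)"
  unfolding divide_inverse by (intro smooth_on_mult smooth_on_inverse assms)

text \<open>
  Every derivative of a solution of the autonomous equation \<open>h' = k \<circ> h\<close> is a smooth function of
  \<open>h\<close>; the functions \<open>f \<circ> h\<close> with \<open>f\<close> smooth are therefore closed under differentiation.
\<close>
lemma smooth_on_ode:
  fixes h k :: "real \<Rightarrow> real"
  assumes k: "smooth_on J k" and J: "h ` I \<subseteq> J"
    and h: "\<And>t. t \<in> I \<Longrightarrow> (h has_vector_derivative k (h t)) (at t within I)"
  shows "smooth_on I h"
proof (rule smooth_on_coinduct[where P = "\<lambda>g. \<exists>f. smooth_on J f \<and> g = (\<lambda>t. f (h t))"])
  show "\<exists>f. smooth_on J f \<and> h = (\<lambda>t. f (h t))"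
    using smooth_on_ident by (intro exI[of _ "\<lambda>t. t"]) simp
next
  fix g :: "real \<Rightarrow> real" assume "\<exists>f. smooth_on J f \<and> g = (\<lambda>t. f (h t))"
  then obtain f where f: "smooth_on J f" and g: "g = (\<lambda>t. f (h t))" by blast
  obtain f' where f': "smooth_on J f'"
      "\<And>t. t \<in> J \<Longrightarrow> (f has_vector_derivative f' t) (at t within J)"
    using f smooth_onE by blast
  have "(g has_vector_derivative k (h t) * f' (h t)) (at t within I)" if "t \<in> I" for t
  proof -
    have "(f has_vector_derivative f' (h t)) (at (h t) within h ` I)"
      using f'(2) J that has_vector_derivative_within_subset by blast
    from vector_diff_chain_within[OF h[OF that] this]
    show ?thesis by (simp add: o_def g)
  qed
  then show "\<exists>g'. (\<exists>f. smooth_on J f \<and> g' = (\<lambda>t. f (h t))) \<and>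
      (\<forall>t\<in>I. (g has_vector_derivative g' t) (at t within I))"
    using smooth_on_mult[OF k f'(1)] by (intro exI[of _ "\<lambda>t. k (h t) * f' (h t)"]) blast
qed

text \<open>
  On an open set derivatives are unique, so local derivatives agree with the globally defined
  \<open>vector_derivative\<close> and fit together.
\<close>
lemma smooth_on_UNIV_local:
  assumes "\<And>t. \<exists>U. open U \<and> t \<in> U \<and> smooth_on U f"
  shows "smooth_on UNIV f"
proof (rule smooth_on_coinduct[where P = "\<lambda>g. \<forall>t. \<exists>U. open U \<and> t \<in> U \<and> smooth_on U g"])
  show "\<forall>t. \<exists>U. open U \<and> t \<in> U \<and> smooth_on U f" using assms by blast
next
  fix g :: "real \<Rightarrow> 'a" assume loc: "\<forall>t. \<exists>U. open U \<and> t \<in> U \<and> smooth_on U g"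
  define g' where "g' t = vector_derivative g (at t)" for t
  have *: "\<exists>U. open U \<and> t \<in> U \<and> smooth_on U g' \<and> (g has_vector_derivative g' t) (at t)" for t
  proof -
    obtain U d where U: "open U" "t \<in> U" "smooth_on U d"
        "\<And>s. s \<in> U \<Longrightarrow> (g has_vector_derivative d s) (at s within U)"
      using loc smooth_onE by metis
    then have "(g has_vector_derivative d s) (at s)" if "s \<in> U" for s
      using that by (metis at_within_open)
    then have "d s = g' s" "(g has_vector_derivative g' s) (at s)" if "s \<in> U" for s
      using that by (metis g'_def vector_derivative_at)+
    with U show ?thesis using smooth_on_cong[of U d g'] by blast
  qed
  then show "\<exists>g'. (\<forall>t. \<exists>U. open U \<and> t \<in> U \<and> smooth_on U g') \<and>
      (\<forall>t\<in>UNIV. (g has_vector_derivative g' t) (at t))"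
    by blast
qed

lemma nonzero_derivative_inverse:
  fixes f f' :: "real \<Rightarrow> real"
  assumes f: "\<And>x. (f has_real_derivative f' x) (at x)" and nz: "\<And>x. f' x \<noteq> 0"
  shows "inj f" "open (range f)"
    "y \<in> range f \<Longrightarrow> (inv f has_real_derivative inverse (f' (inv f y))) (at y)"
proof -
  have ne: "f a \<noteq> f b" if "a < b" for a b
    using Rolle_deriv[OF that, of f "\<lambda>x. (*) (f' x)"] f nz
    by (metis (no_types, lifting) DERIV_continuous_on has_field_derivative_at_within
        has_field_derivative_def mult.right_neutral)
  then show inj: "inj f" by (metis injI linorder_less_linear)
  have cont: "continuous_on UNIV f" by (rule DERIV_continuous_on) (rule f)
  show op: "open (range f)"
    using injective_into_1d_imp_open_map_UNIV[OF open_UNIV cont] inj by auto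
  show "(inv f has_real_derivative inverse (f' (inv f y))) (at y)" if y: "y \<in> range f"
  proof -
    obtain e where e: "e > 0" "ball y e \<subseteq> range f" using op y open_contains_ball by blast
    obtain g where "homeomorphism UNIV (range f) f g"
      using injective_into_1d_eq_homeomorphism[OF cont] inj by auto
    then have ci: "continuous_on (range f) (inv f)"
      using inj by (auto simp: homeomorphism_def intro: continuous_on_eq)
    show ?thesis
    proof (rule DERIV_inverse_function[where a = "y - e" and b = "y + e"])
      show "isCont (inv f) y" using ci op y continuous_on_eq_continuous_at by blast
      show "f (inv f z) = z" if "y - e < z" "z < y + e" for z
        using that e(2) by (intro f_inv_into_f) (auto simp: dist_real_def)
    qed (use f nz e in auto)
  qed
qed

text \<open>
  The inverse of \<open>f\<close> solves the autonomous equation \<open>h' = 1 / f' \<circ> h\<close>.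
\<close>
lemma smooth_on_inv:
  fixes f :: "real \<Rightarrow> real"
  assumes f: "smooth_on UNIV f" and nz: "\<And>x. vector_derivative f (at x) \<noteq> 0"
  shows "smooth_on (range f) (inv f)"
proof -
  obtain f' where f': "smooth_on UNIV f'" "\<And>t. (f has_vector_derivative f' t) (at t)"
    using f by (metis smooth_onE UNIV_I)
  have nz': "f' t \<noteq> 0" for t using nz f'(2) by (metis vector_derivative_at)
  show ?thesis
  proof (rule smooth_on_ode[where J = UNIV and k = "\<lambda>t. inverse (f' t)"])
    show "smooth_on UNIV (\<lambda>t. inverse (f' t))" by (intro smooth_on_inverse f' nz')
    show "(inv f has_vector_derivative inverse (f' (inv f t))) (at t within range f)"
      if "t \<in> range f" for t
    proof -
      have "(f has_real_derivative f' x) (at x)" for x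
        using f'(2) by (simp add: has_real_derivative_iff_has_vector_derivative)
      from nonzero_derivative_inverse(3)[OF this nz' that] show ?thesis
        by (simp add: has_real_derivative_iff_has_vector_derivative has_vector_derivative_at_within)
    qed
  qed auto
qed

lemma has_vector_derivative_compose_real:
  assumes "(f has_vector_derivative f') (at (h t))" "(h has_vector_derivative h') (at t within I)"
  shows "((\<lambda>t. f (h t)) has_vector_derivative h' *\<^sub>R f') (at t within I)"
  using vector_diff_chain_within[OF assms(2) has_vector_derivative_at_within[OF assms(1)]]
  by (simp add: o_def)

lemma smooth_on_UNIV_vector_derivative:
  assumes "smooth_on UNIV f"
  shows "smooth_on UNIV (\<lambda>t. vector_derivative f (at t))"
    and "(f has_vector_derivative vector_derivative f (at t)) (at t)"
proof -
  obtain f' where f': "smooth_on UNIV f'" "\<And>t. (f has_vector_derivative f' t) (at t)"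
    using smooth_onE[OF assms] by (metis UNIV_I)
  have "f' = (\<lambda>t. vector_derivative f (at t))"
    using f'(2) by (metis vector_derivative_at)
  with f' show "smooth_on UNIV (\<lambda>t. vector_derivative f (at t))"
    and "(f has_vector_derivative vector_derivative f (at t)) (at t)" by auto
qed

lemma vector_derivative_periodic:
  assumes "smooth_on UNIV f" "\<And>t. f (t + c) = f t"
  shows "vector_derivative f (at (t + c)) = vector_derivative f (at t)"
proof -
  have "((\<lambda>t. t + c) has_vector_derivative 1) (at t)"
    by (auto intro!: derivative_eq_intros)
  from has_vector_derivative_compose_real[OF smooth_on_UNIV_vector_derivative(2)[OF assms(1)] this]
  have "(f has_vector_derivative vector_derivative f (at (t + c))) (at t)"
    by (simp add: assms(2))
  then show ?thesis by (simp add: vector_derivative_at)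
qed

section \<open>Smooth logarithms of planar curves\<close>

lemma at_within_interval_nontrivial:
  fixes I :: "real set"
  assumes "is_interval I" "interior I \<noteq> {}" "t \<in> I"
  shows "at t within I \<noteq> bot"
proof -
  have "\<not> finite I" using assms(2) by (metis interior_subset infinite_super open_interior finite_imp_not_open) 
  then have "I \<noteq> {x}" for x by auto
  then have "t islimpt I" using connected_imp_perfect[of I t] assms is_interval_connected by blast
  then show ?thesis by (simp add: trivial_limit_within)
qed

lemma continuous_antiderivative_interval:
  fixes f :: "real \<Rightarrow> 'b::euclidean_space"
  assumes I: "is_interval I" and f: "continuous_on I f"
  obtains F where "\<And>t. t \<in> I \<Longrightarrow> (F has_vector_derivative f t) (at t within I)"
proof (cases "I = {}")
  case False
  then obtain c where c: "c \<in> I" by blast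
  have "((\<lambda>u. LBINT y=c..u. f y) has_vector_derivative f t) (at t within I)" if t: "t \<in> I" for t
  proof -
    obtain a where a: "a \<in> I" "a \<le> t" "a < t \<or> (\<forall>x\<in>I. t \<le> x)"
      using t by (metis less_imp_le not_less order_refl)
    obtain b where b: "b \<in> I" "t \<le> b" "t < b \<or> (\<forall>x\<in>I. x \<le> t)"
      using t by (metis less_imp_le not_less order_refl)
    have sub: "{min a c..max b c} \<subseteq> I"
    proof
      fix x assume x: "x \<in> {min a c..max b c}"
      have ab: "min a c \<in> I" "max b c \<in> I"
        using a(1) b(1) c by (simp_all add: min_def max_def)
      show "x \<in> I" using mem_is_interval_1_I[OF I ab] x unfolding atLeastAtMost_iff by blast
    qed
    \<comment> \<open>Near \<open>t\<close> the interval \<open>I\<close> coincides with \<open>[a, b]\<close>, also when \<open>t\<close> is an end point of \<open>I\<close>.\<close>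
    define U where "U = {(if a < t then a else t - 1)<..<(if t < b then b else t + 1)}"
    have "at t within I = at t within {min a c..max b c}"
    proof (rule at_within_nhd)
      show "t \<in> U" "open U" using a b by (auto simp: U_def)
      have "I \<inter> U \<subseteq> {min a c..max b c}"
      proof
        fix x assume "x \<in> I \<inter> U"
        then have "a \<le> x \<and> x \<le> b"
          using a b by (cases "a < t"; cases "t < b") (auto simp: U_def)
        then show "x \<in> {min a c..max b c}" by auto
      qed
      with sub show "I \<inter> U - {t} = {min a c..max b c} \<inter> U - {t}" by blast
    qed
    moreover have "((\<lambda>u. LBINT y=c..u. f y) has_vector_derivative f t)
        (at t within {min a c..max b c})"
      using a b by (intro interval_integral_FTC2 continuous_on_subset[OF f sub]) auto
    ultimately show ?thesis by simp
  qed
  then show ?thesis using that by blast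
qed (use that in auto)

text \<open>
  A smooth logarithm is obtained without covering spaces: if \<open>F\<close> is an antiderivative of \<open>z' / z\<close>,
  then \<open>z * exp (- F)\<close> has derivative zero on the interval and is constant. The imaginary part of the
  logarithm is a smooth polar angle of \<open>z\<close>.
\<close>
lemma smooth_logarithm:
  fixes z :: "real \<Rightarrow> complex"
  assumes I: "is_interval I" and z: "smooth_on I z" and nz: "\<And>t. t \<in> I \<Longrightarrow> z t \<noteq> 0"
  obtains g where "smooth_on I g" "\<And>t. t \<in> I \<Longrightarrow> z t = exp (g t)"
    "\<And>t d. t \<in> I \<Longrightarrow> at t within I \<noteq> bot \<Longrightarrow> (z has_vector_derivative d) (at t within I) \<Longrightarrow>
        (g has_vector_derivative d / z t) (at t within I)"
proof (cases "I = {}")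
  case False
  then obtain c where c: "c \<in> I" by blast
  obtain z' where z': "smooth_on I z'"
      "\<And>t. t \<in> I \<Longrightarrow> (z has_vector_derivative z' t) (at t within I)"
    using z smooth_onE by blast
  have q: "smooth_on I (\<lambda>t. z' t / z t)" by (intro smooth_on_divide z' z nz)
  obtain F where F: "\<And>t. t \<in> I \<Longrightarrow> (F has_vector_derivative z' t / z t) (at t within I)"
    using continuous_antiderivative_interval[OF I smooth_on_imp_continuous_on[OF q]] by blast
  define k where "k = z c * exp (- F c)"
  have const: "z t * exp (- F t) = k" if "t \<in> I" for t
  proof -
    have "((\<lambda>t. z t * exp (- F t)) has_derivative (\<lambda>h. 0)) (at t within I)" if "t \<in> I" for t
    proof -
      have "((\<lambda>t. exp (- F t)) has_vector_derivative - (z' t / z t) * exp (- F t)) (at t within I)"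
        using field_vector_diff_chain_within[OF has_vector_derivative_minus[OF F[OF that]]
            has_field_derivative_at_within[OF DERIV_exp]]
        by (simp add: o_def)
      from has_vector_derivative_mult[OF z'(2)[OF that] this] nz[OF that]
      show ?thesis unfolding has_vector_derivative_def by simp
    qed
    from has_derivative_zero_constant[OF is_interval_convex[OF I] this] c that
    show ?thesis by (metis k_def)
  qed
  have "k \<noteq> 0" using nz c by (simp add: k_def)
  define g where "g t = F t + Ln k" for t
  have g: "(g has_vector_derivative z' t / z t) (at t within I)" if "t \<in> I" for t
    unfolding g_def using F[OF that] by (auto intro!: derivative_eq_intros)
  have "z t = exp (g t)" if "t \<in> I" for t
    using const[OF that] \<open>k \<noteq> 0\<close> by (simp add: g_def exp_add exp_minus field_simps)
  moreover have "smooth_on I g" by (rule smooth_onI_derivative[OF q g])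
  moreover have "(g has_vector_derivative d / z t) (at t within I)"
    if "t \<in> I" "at t within I \<noteq> bot" "(z has_vector_derivative d) (at t within I)" for t d
    using g[OF that(1)] z'(2)[OF that(1)] that vector_derivative_unique_within by metis
  ultimately show ?thesis using that by blast
qed (use that in \<open>auto simp: smooth_on_def\<close>)

section \<open>Birkhoff orthogonality\<close>

lemma birkhoff_orth_scaleR_right: "v \<stileturn>\<^sub>B w \<Longrightarrow> v \<stileturn>\<^sub>B c *\<^sub>R w"
  by (simp add: birkhoff_orth_def)

lemma birkhoff_orth_scaleR_left:
  assumes "v \<stileturn>\<^sub>B w" shows "c *\<^sub>R v \<stileturn>\<^sub>B w"
proof (cases "c = 0")
  case False
  have "norm (c *\<^sub>R v) \<le> norm (c *\<^sub>R v + t *\<^sub>R w)" for t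
  proof -
    have "c *\<^sub>R v + t *\<^sub>R w = c *\<^sub>R (v + (t / c) *\<^sub>R w)"
      using False by (simp add: scaleR_add_right)
    moreover have "norm v \<le> norm (v + (t / c) *\<^sub>R w)"
      using assms by (simp add: birkhoff_orth_def)
    ultimately show ?thesis by (simp add: mult_left_mono)
  qed
  then show ?thesis by (simp add: birkhoff_orth_def)
qed (simp add: birkhoff_orth_def)

text \<open>
  If the norm were smaller than 1 somewhere on the tangent line, then by convexity it would decrease
  at least linearly from \<open>f u\<close> towards that point. But \<open>f\<close> agrees with the tangent line to first order
  and keeps norm 1.
\<close>
lemma birkhoff_orth_tangent:
  fixes f :: "real \<Rightarrow> 'a::real_normed_vector"
  assumes f: "\<And>s. norm (f s) = 1" and d: "(f has_vector_derivative d) (at u)"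
  shows "f u \<stileturn>\<^sub>B d"
  unfolding birkhoff_orth_def f
proof (rule ccontr)
  assume "\<not> (\<forall>t. 1 \<le> norm (f u + t *\<^sub>R d))"
  then obtain t where t: "norm (f u + t *\<^sub>R d) < 1" by (auto simp: not_le)
  define e where "e = 1 - norm (f u + t *\<^sub>R d)"
  have "((\<lambda>h. f (u + h * t)) has_vector_derivative t *\<^sub>R d) (at 0)"
    by (rule has_vector_derivative_compose_real) (use d in \<open>auto intro!: derivative_eq_intros\<close>)
  then have lim: "\<forall>\<epsilon>>0. \<exists>\<delta>>0. \<forall>h. norm (h - 0) < \<delta> \<longrightarrow>
      norm (f (u + h * t) - f (u + 0 * t) - (h - 0) *\<^sub>R t *\<^sub>R d) \<le> \<epsilon> * norm (h - 0)"
    unfolding has_vector_derivative_def has_derivative_within_alt by blast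
  have "e > 0" using t by (simp add: e_def)
  then obtain \<delta> where "\<delta> > 0" and \<delta>: "\<And>h. \<bar>h\<bar> < \<delta> \<Longrightarrow>
      norm (f (u + h * t) - f u - h *\<^sub>R t *\<^sub>R d) \<le> e / 2 * \<bar>h\<bar>"
    using lim[rule_format, of "e / 2"] by auto
  define h where "h = min (\<delta> / 2) 1"
  have h: "0 < h" "h \<le> 1" "\<bar>h\<bar> < \<delta>" using \<open>\<delta> > 0\<close> by (auto simp: h_def)
  have tri: "norm (a + b + c) \<le> norm a + norm b + norm c" for a b c :: 'a
    by (rule order_trans[OF norm_triangle_ineq]) (simp add: norm_triangle_ineq)
  \<comment> \<open>A convex combination with weight \<open>h\<close> plus the error of the linear approximation.\<close>
  have eq: "f (u + h * t) = (1 - h) *\<^sub>R f u + h *\<^sub>R (f u + t *\<^sub>R d)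
      + (f (u + h * t) - f u - h *\<^sub>R t *\<^sub>R d)"
    by (simp add: algebra_simps)
  have "norm (f (u + h * t)) \<le> norm ((1 - h) *\<^sub>R f u) + norm (h *\<^sub>R (f u + t *\<^sub>R d))
      + norm (f (u + h * t) - f u - h *\<^sub>R t *\<^sub>R d)"
    by (subst eq) (rule tri)
  also have "\<dots> \<le> (1 - h) + h * (1 - e) + e / 2 * h"
    using \<delta>[OF h(3)] h f by (simp add: e_def)
  also have "\<dots> = 1 - e / 2 * h" by (simp add: algebra_simps)
  also have "\<dots> < 1" using h \<open>e > 0\<close> by simp
  finally show False using f by simp
qed

context normed_plane
begin

lemma antisymmetric: "\<omega> x y = - \<omega> y x"
proof -
  have "\<omega> (x + y) (x + y) = \<omega> x y + \<omega> y x"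
    by (simp add: bilinear_ladd[OF bilinear] bilinear_radd[OF bilinear] alternating[of x] alternating[of y])
  then show ?thesis using alternating[of "x + y"] by linarith
qed

text \<open>
  Both points minimize the norm on the line through them in direction \<open>w\<close>, so by convexity the norm
  is constant on the segment between them. Scaled to norm one, this segment would lie on the unit
  circle.
\<close>
lemma birkhoff_orth_left_unique:
  fixes a w :: 'a
  assumes "a \<stileturn>\<^sub>B w" "a + s *\<^sub>R w \<stileturn>\<^sub>B w" "w \<noteq> 0"
  shows "s = 0"
proof (rule ccontr)
  assume "s \<noteq> 0"
  define m where "m = norm a"
  have ge: "m \<le> norm (a + t *\<^sub>R w)" for t
    using assms(1) by (simp add: birkhoff_orth_def m_def)
  have "norm (a + s *\<^sub>R w) \<le> norm ((a + s *\<^sub>R w) + (- s) *\<^sub>R w)"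
    using assms(2) unfolding birkhoff_orth_def by blast
  then have le: "norm (a + s *\<^sub>R w) \<le> m" by (simp add: m_def)
  show False
  proof (cases "m = 0")
    case True
    then show False using le \<open>s \<noteq> 0\<close> \<open>w \<noteq> 0\<close> by (auto simp: m_def mult_le_0_iff)
  next
    case False
    then have m: "m > 0" by (simp add: m_def)
    have "closed_segment (a /\<^sub>R m) ((a + s *\<^sub>R w) /\<^sub>R m) \<subseteq> sphere 0 1"
    proof
      fix x assume "x \<in> closed_segment (a /\<^sub>R m) ((a + s *\<^sub>R w) /\<^sub>R m)"
      then obtain u where u: "0 \<le> u" "u \<le> 1"
          and x: "x = (1 - u) *\<^sub>R (a /\<^sub>R m) + u *\<^sub>R ((a + s *\<^sub>R w) /\<^sub>R m)"
        by (auto simp: in_segment)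
      have mx: "m *\<^sub>R x = (1 - u) *\<^sub>R a + u *\<^sub>R (a + s *\<^sub>R w)"
      proof -
        have *: "m *\<^sub>R c *\<^sub>R (v /\<^sub>R m) = c *\<^sub>R v" for c and v :: 'a using m by simp
        show ?thesis by (simp only: x scaleR_add_right[of m] *)
      qed
      have "norm (m *\<^sub>R x) \<le> (1 - u) * m + u * m"
        using u le m_def unfolding mx
        by (intro order_trans[OF norm_triangle_ineq] add_mono) (auto simp: mult_left_mono)
      then have "m * norm x \<le> m" using m by (simp add: algebra_simps)
      moreover have "m *\<^sub>R x = a + (u * s) *\<^sub>R w"
        unfolding mx by (simp add: algebra_simps)
      then have "m \<le> m * norm x" using ge[of "u * s"] m by (metis abs_of_pos norm_scaleR)
      ultimately show "x \<in> sphere 0 1" using m by simp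
    qed
    moreover have "a /\<^sub>R m \<noteq> (a + s *\<^sub>R w) /\<^sub>R m"
      using m \<open>s \<noteq> 0\<close> \<open>w \<noteq> 0\<close> by simp
    ultimately show False using strictly_convex by blast
  qed
qed

end

section \<open>Complex coordinates on a normed plane\<close>

definition cross :: "complex \<Rightarrow> complex \<Rightarrow> real"
  where "cross a b = Im (cnj a * b)"

lemma cross_simps [simp]:
  "cross a (b + c) = cross a b + cross a c" "cross (b + c) a = cross b a + cross c a"
  "cross a (r *\<^sub>R b) = r * cross a b" "cross (r *\<^sub>R a) b = r * cross a b"
  "cross a a = 0"
  by (simp_all add: cross_def algebra_simps)

lemma cross_commute: "cross a b = - cross b a"
  by (simp add: cross_def)

lemma cross_expansion: "cross a b *\<^sub>R z = cross z b *\<^sub>R a + cross a z *\<^sub>R b"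
  by (simp add: cross_def complex_eq_iff algebra_simps)

lemma Im_divide_cross: "Im (b / a) = cross a b / (cmod a)\<^sup>2"
  unfolding cross_def by (subst complex_div_cnj) (simp add: Im_divide_of_real mult.commute)

lemma cross_eq_0_parallel:
  assumes "cross a b = 0" "a \<noteq> 0" obtains c :: real where "b = c *\<^sub>R a"
proof -
  have "b = (b / a) * a" using assms(2) by simp
  also have "b / a = of_real (Re (b / a))"
    using assms(1) by (simp add: complex_eq_iff Im_divide_cross)
  finally show ?thesis using that[of "Re (b / a)"] by (simp add: scaleR_conv_of_real)
qed

lemma smooth_on_cross:
  assumes "smooth_on I f" "smooth_on I g"
  shows "smooth_on I (\<lambda>t. cross (f t) (g t))"
  unfolding cross_def
  by (intro smooth_on_bounded_linear[OF bounded_linear_Im] smooth_on_mult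
      smooth_on_bounded_linear[OF bounded_linear_cnj] assms)

lemma smooth_on_scaleR:
  fixes f :: "real \<Rightarrow> complex"
  assumes "smooth_on I r" "smooth_on I f"
  shows "smooth_on I (\<lambda>t. r t *\<^sub>R f t)"
  unfolding scaleR_conv_of_real
  by (intro smooth_on_mult smooth_on_bounded_linear[OF bounded_linear_of_real] assms)

lemma vector_derivative_real_valued:
  assumes "(f has_vector_derivative d) (at t)" "\<And>s. Im (f s) = 0"
  shows "Im d = 0"
proof -
  have "((\<lambda>s. Im (f s)) has_vector_derivative Im d) (at t)"
    by (rule bounded_linear.has_vector_derivative[OF bounded_linear_Im assms(1)])
  then have "((\<lambda>_. 0) has_vector_derivative Im d) (at t)" by (simp add: assms(2))
  then show ?thesis using vector_derivative_unique_at has_vector_derivative_const by blast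
qed

text \<open>
  Coordinates in which the symplectic form is the determinant. They turn the plane into the complex
  numbers, so that polar angles and logarithms become available.
\<close>
locale plane_coordinates = normed_plane \<omega>
  for \<omega> :: "'a::real_normed_vector \<Rightarrow> 'a \<Rightarrow> real" +
  fixes L :: "complex \<Rightarrow> 'a" and C :: "'a \<Rightarrow> complex"
  assumes bounded_linear_L: "bounded_linear L" and bounded_linear_C: "bounded_linear C"
    and C_L [simp]: "C (L z) = z" and L_C [simp]: "L (C v) = v"
    and omega_L: "\<omega> (L a) (L b) = cross a b"

lemma (in normed_plane) ex_plane_coordinates: "\<exists>L C. plane_coordinates \<omega> L C"
proof -
  obtain B :: "'a set" where B: "independent B" "UNIV \<subseteq> span B" "card B = 2"
    using basis_exists[of "UNIV :: 'a set"] dim_2 by metis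
  obtain b1 b2 where b: "B = {b1, b2}" "b1 \<noteq> b2" using B(3) by (auto simp: card_2_iff)
  have span: "\<exists>x y. v = x *\<^sub>R b1 + y *\<^sub>R b2" for v
  proof -
    have "v \<in> span {b1, b2}" using B(2) b(1) by auto
    then obtain x where "v - x *\<^sub>R b1 \<in> span {b2}" by (auto simp: span_insert)
    then obtain y where "v - x *\<^sub>R b1 = y *\<^sub>R b2" by (auto simp: span_singleton)
    then have "v = x *\<^sub>R b1 + y *\<^sub>R b2" by (simp add: algebra_simps)
    then show ?thesis by blast
  qed
  note bil = bilinear_ladd[OF bilinear] bilinear_radd[OF bilinear]
    bilinear_lmul[OF bilinear] bilinear_rmul[OF bilinear] alternating
  define d where "d = \<omega> b1 b2"
  have "d \<noteq> 0"
  proof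
    assume "d = 0"
    have "\<omega> b1 v = 0" for v
    proof -
      obtain x y where "v = x *\<^sub>R b1 + y *\<^sub>R b2" using span by blast
      then show ?thesis using \<open>d = 0\<close> by (simp add: bil d_def)
    qed
    then have "b1 = 0" by (rule nondegenerate)
    then show False using B(1) b(1) dependent_zero by blast
  qed
  define e2 where "e2 = b2 /\<^sub>R d"
  have b1e2: "\<omega> b1 e2 = 1" "\<omega> e2 b1 = - 1"
    using \<open>d \<noteq> 0\<close> antisymmetric[of e2 b1] by (simp_all add: e2_def bil d_def[symmetric])
  define L where "L z = Re z *\<^sub>R b1 + Im z *\<^sub>R e2" for z
  define C where "C v = Complex (\<omega> v e2) (\<omega> b1 v)" for v
  have L: "bounded_linear L"
    unfolding L_def
    by (intro bounded_linear_add bounded_linear_compose[OF bounded_linear_scaleR_left]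
        bounded_linear_Re bounded_linear_Im)
  have CL: "C (L z) = z" for z
    by (simp add: C_def L_def bil b1e2 complex_eq_iff)
  have LC: "L (C v) = v" for v
  proof -
    obtain x y where v: "v = x *\<^sub>R b1 + y *\<^sub>R b2" using span by blast
    have "v = x *\<^sub>R b1 + (y * d) *\<^sub>R e2" using \<open>d \<noteq> 0\<close> by (simp add: v e2_def)
    then show ?thesis by (simp add: C_def L_def bil b1e2)
  qed
  \<comment> \<open>Compactness of the Euclidean unit circle bounds the norm of the plane from below.\<close>
  have cont: "continuous_on (sphere 0 1) (\<lambda>z. norm (L z))"
    by (intro continuous_on_norm linear_continuous_on L)
  obtain z0 :: complex where z0: "z0 \<in> sphere 0 1"
      "\<And>z. z \<in> sphere 0 1 \<Longrightarrow> norm (L z0) \<le> norm (L z)"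
    using continuous_attains_inf[OF compact_sphere _ cont] by (auto simp: sphere_eq_empty)
  define m where "m = norm (L z0)"
  have "L z0 \<noteq> 0"
  proof
    assume "L z0 = 0"
    then have "L z0 = L 0" using L by (simp add: linear_simps)
    then have "z0 = 0" by (metis CL)
    then show False using z0(1) by simp
  qed
  then have "m > 0" by (simp add: m_def)
  have below: "m * cmod z \<le> norm (L z)" for z
  proof (cases "z = 0")
    case False
    have "L (z /\<^sub>R cmod z) = L z /\<^sub>R cmod z"
      using L by (simp add: linear_simps)
    then show ?thesis
      using z0(2)[of "z /\<^sub>R cmod z"] False by (simp add: m_def field_simps)
  qed simp
  have "bounded_linear C"
  proof (rule bounded_linear_intro)
    show "norm (C v) \<le> norm v * (1 / m)" for v
      using below[of "C v"] \<open>m > 0\<close> by (simp add: LC field_simps)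
  qed (simp_all add: C_def bil complex_eq_iff)
  moreover have "\<omega> (L a) (L b) = cross a b" for a b
    by (simp add: L_def bil b1e2 cross_def)
  ultimately have "plane_coordinates \<omega> L C"
    using L CL LC
    by (intro plane_coordinates.intro normed_plane_axioms plane_coordinates_axioms.intro)
  then show ?thesis by blast
qed

context plane_coordinates
begin

lemma L_simps:
  "L (a + b) = L a + L b" "L (a - b) = L a - L b" "L (r *\<^sub>R a) = r *\<^sub>R L a" "L 0 = 0"
  using bounded_linear_L by (simp_all add: linear_simps)

lemma C_simps:
  "C (v + w) = C v + C w" "C (v - w) = C v - C w" "C (r *\<^sub>R v) = r *\<^sub>R C v" "C 0 = 0"
  using bounded_linear_C by (simp_all add: linear_simps)

lemma L_eq_0_iff [simp]: "L z = 0 \<longleftrightarrow> z = 0"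
proof
  assume "L z = 0"
  then have "C (L z) = C 0" by (rule arg_cong)
  then show "z = 0" by (simp add: C_simps)
qed (simp add: L_simps)

lemma C_eq_0_iff [simp]: "C v = 0 \<longleftrightarrow> v = 0"
proof
  assume "C v = 0"
  then have "L (C v) = L 0" by (rule arg_cong)
  then show "v = 0" by (simp add: L_simps)
qed (simp add: C_simps)

lemma omega_C: "\<omega> v w = cross (C v) (C w)"
  using omega_L[of "C v" "C w"] by simp

section \<open>The unit circle in polar coordinates\<close>

definition polar :: "real \<Rightarrow> complex"
  where "polar s = cis s /\<^sub>R norm (L (cis s))"

abbreviation polar' :: "real \<Rightarrow> complex"
  where "polar' s \<equiv> vector_derivative polar (at s)"

abbreviation polar'' :: "real \<Rightarrow> complex"
  where "polar'' s \<equiv> vector_derivative polar' (at s)"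

lemma norm_L_polar [simp]: "norm (L (polar s)) = 1"
  by (simp add: polar_def L_simps)

lemma polar_nonzero [simp]: "polar s \<noteq> 0"
  by (simp add: polar_def)

lemma polar_periodic: "polar (s + 2 * pi) = polar s"
  by (simp add: polar_def cis_mult[symmetric])

lemma polar_periodic_int: "polar (s + 2 * pi * of_int n) = polar s"
proof -
  have "cis (2 * pi * of_int n) = 1" by (simp add: complex_eq_iff sin_integer_2pi cos_integer_2pi)
  then show ?thesis by (simp add: polar_def cis_mult[symmetric])
qed

lemma exp_eq_polar_Im:
  assumes "norm (L (exp w)) = 1"
  shows "exp w = polar (Im w)"
proof -
  have w: "exp w = exp (Re w) *\<^sub>R cis (Im w)" by (simp add: exp_eq_polar scaleR_conv_of_real)
  have "exp (Re w) * norm (L (cis (Im w))) = 1" using assms unfolding w by (simp add: L_simps)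
  then show ?thesis unfolding w polar_def by (simp add: field_simps inverse_eq_divide)
qed

lemma polar_eq_imp:
  assumes "polar s = polar t" shows "\<exists>n::int. s = t + 2 * pi * of_int n"
proof -
  have eq: "cis s = (norm (L (cis s)) / norm (L (cis t))) *\<^sub>R cis t"
  proof -
    have "norm (L (cis s)) \<noteq> 0" "norm (L (cis t)) \<noteq> 0" by simp_all
    then show ?thesis using assms
      unfolding polar_def by (simp add: field_simps scaleR_conv_of_real)
  qed
  have "cmod (cis s) = norm (L (cis s)) / norm (L (cis t)) * cmod (cis t)"
    by (subst eq) (simp only: norm_scaleR abs_divide abs_norm_cancel)
  then have "norm (L (cis s)) / norm (L (cis t)) = 1" by simp
  with eq have "cis s = cis t" by simp
  from arg_cong[OF this, of Re] arg_cong[OF this, of Im] have "sin s = sin t \<and> cos s = cos t"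
    by simp
  then show ?thesis by (simp add: sin_cos_eq_iff)
qed

text \<open>
  A unit vector is determined by its polar angle, so a smooth curve on the unit circle lifts to a
  smooth real function. The formula for the angular velocity is the imaginary part of the
  logarithmic derivative.
\<close>
lemma unit_curve_angle:
  assumes I: "is_interval I" and f: "smooth_on I f" and unit: "\<And>t. t \<in> I \<Longrightarrow> norm (f t) = 1"
  obtains \<theta> where "smooth_on I \<theta>" "\<And>t. t \<in> I \<Longrightarrow> f t = L (polar (\<theta> t))"
    "\<And>t d. t \<in> I \<Longrightarrow> at t within I \<noteq> bot \<Longrightarrow> (f has_vector_derivative d) (at t within I) \<Longrightarrow>
        (\<theta> has_vector_derivative \<omega> (f t) d / (cmod (C (f t)))\<^sup>2) (at t within I)"
proof -
  have nz: "C (f t) \<noteq> 0" if "t \<in> I" for t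
    using unit[OF that] by auto
  obtain g where g: "smooth_on I g" "\<And>t. t \<in> I \<Longrightarrow> C (f t) = exp (g t)"
    "\<And>t d. t \<in> I \<Longrightarrow> at t within I \<noteq> bot \<Longrightarrow>
        ((\<lambda>t. C (f t)) has_vector_derivative d) (at t within I) \<Longrightarrow>
        (g has_vector_derivative d / C (f t)) (at t within I)"
    using smooth_logarithm[OF I smooth_on_bounded_linear[OF bounded_linear_C f] nz] by blast
  show ?thesis
  proof (rule that[of "\<lambda>t. Im (g t)"])
    show "smooth_on I (\<lambda>t. Im (g t))"
      by (intro smooth_on_bounded_linear[OF bounded_linear_Im] g)
    show "f t = L (polar (Im (g t)))" if "t \<in> I" for t
      using exp_eq_polar_Im[of "g t"] g(2)[OF that] unit[OF that] by (metis L_C)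
    show "((\<lambda>t. Im (g t)) has_vector_derivative \<omega> (f t) d / (cmod (C (f t)))\<^sup>2) (at t within I)"
      if "t \<in> I" "at t within I \<noteq> bot" "(f has_vector_derivative d) (at t within I)" for t d
      using bounded_linear.has_vector_derivative[OF bounded_linear_Im g(3)[OF that(1,2)
          bounded_linear.has_vector_derivative[OF bounded_linear_C that(3)]]]
      by (simp add: Im_divide_cross omega_C)
  qed
qed

text \<open>
  The position \<open>\<phi> u\<close> is Birkhoff orthogonal to the nonzero velocity, which is therefore not a multiple
  of it, so the polar angle moves with nonzero speed.
\<close>
lemma circle_param_angle:
  assumes "unit_circle_param \<phi>"
  obtains \<theta> where "smooth_on UNIV \<theta>" "\<And>u. \<phi> u = L (polar (\<theta> u))"
    "\<And>u. vector_derivative \<theta> (at u) \<noteq> 0"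
proof -
  have \<phi>: "smooth_on UNIV \<phi>" "range \<phi> = sphere 0 1" "\<And>u. vector_derivative \<phi> (at u) \<noteq> 0"
    using assms by (auto simp: unit_circle_param_def)
  have unit: "norm (\<phi> u) = 1" for u using \<phi>(2) by (metis mem_sphere_0 rangeI)
  note der = smooth_on_UNIV_vector_derivative(2)[OF \<phi>(1)]
  obtain \<theta> where \<theta>: "smooth_on UNIV \<theta>" "\<And>u. \<phi> u = L (polar (\<theta> u))"
    "\<And>u d. (\<phi> has_vector_derivative d) (at u) \<Longrightarrow>
        (\<theta> has_vector_derivative \<omega> (\<phi> u) d / (cmod (C (\<phi> u)))\<^sup>2) (at u)"
    using unit_curve_angle[OF is_interval_univ \<phi>(1) unit] by (metis UNIV_I trivial_limit_at)
  have "vector_derivative \<theta> (at u) \<noteq> 0" for u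
  proof
    assume "vector_derivative \<theta> (at u) = 0"
    then have "\<omega> (\<phi> u) (vector_derivative \<phi> (at u)) / (cmod (C (\<phi> u)))\<^sup>2 = 0"
      using \<theta>(3)[OF der] by (metis vector_derivative_at)
    moreover have "C (\<phi> u) \<noteq> 0" using \<theta>(2) by simp
    ultimately have "cross (C (\<phi> u)) (C (vector_derivative \<phi> (at u))) = 0"
      by (simp add: omega_C)
    then obtain c where "C (vector_derivative \<phi> (at u)) = c *\<^sub>R C (\<phi> u)"
      using \<open>C (\<phi> u) \<noteq> 0\<close> by (rule cross_eq_0_parallel)
    then have c: "vector_derivative \<phi> (at u) = c *\<^sub>R \<phi> u" by (metis C_simps(3) L_C)
    have "\<phi> u \<stileturn>\<^sub>B vector_derivative \<phi> (at u)" by (rule birkhoff_orth_tangent[OF unit der])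
    then have "norm (\<phi> u) \<le> norm (\<phi> u + (- 1 / c) *\<^sub>R vector_derivative \<phi> (at u))"
      unfolding birkhoff_orth_def by blast
    moreover have "c \<noteq> 0" using c \<phi>(3) by auto
    ultimately show False using unit by (simp add: c)
  qed
  with \<theta> show ?thesis using that by blast
qed

text \<open>
  If \<open>\<phi>\<close> parametrizes the unit circle and \<open>\<theta>\<close> is its polar angle, then \<open>polar = C \<circ> \<phi> \<circ> inv \<theta>\<close>
  on the range of \<open>\<theta>\<close>. This range may be a proper subset of the line, but its translates by multiples of
  \<open>2 * pi\<close> are open and cover the line because \<open>\<phi>\<close> is onto.
\<close>
lemma smooth_polar: "smooth_on UNIV polar"
proof (rule smooth_on_UNIV_local)
  fix s
  obtain \<phi> :: "real \<Rightarrow> 'a" where \<phi>: "unit_circle_param \<phi>" using smooth_circle by blast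
  obtain \<theta> where \<theta>: "smooth_on UNIV \<theta>" "\<And>u. \<phi> u = L (polar (\<theta> u))"
    "\<And>u. vector_derivative \<theta> (at u) \<noteq> 0"
    using circle_param_angle[OF \<phi>] by blast
  have \<theta>_DERIV: "(\<theta> has_real_derivative vector_derivative \<theta> (at u)) (at u)" for u
    using smooth_on_UNIV_vector_derivative(2)[OF \<theta>(1)]
    by (simp add: has_real_derivative_iff_has_vector_derivative)
  obtain u where "\<phi> u = L (polar s)"
    using \<phi> norm_L_polar[of s] unfolding unit_circle_param_def by (metis imageE mem_sphere_0)
  then have "polar s = polar (\<theta> u)" using \<theta>(2) by (metis C_L)
  then obtain n :: int where n: "s = \<theta> u + 2 * pi * of_int n" using polar_eq_imp by blast
  define U where "U = (\<lambda>x. x - 2 * pi * of_int n) -` range \<theta>"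
  have "open U"
    unfolding U_def
    by (intro open_vimage nonzero_derivative_inverse(2)[OF \<theta>_DERIV \<theta>(3)] continuous_intros)
  moreover have "s \<in> U" using n by (simp add: U_def)
  moreover have "smooth_on U polar"
  proof (rule smooth_on_cong)
    have inv: "smooth_on (range \<theta>) (inv \<theta>)" by (rule smooth_on_inv[OF \<theta>(1,3)])
    have "smooth_on UNIV (\<lambda>u. C (\<phi> u))"
      using \<phi> smooth_on_bounded_linear[OF bounded_linear_C] by (simp add: unit_circle_param_def)
    then have "smooth_on (range \<theta>) (\<lambda>x. C (\<phi> (inv \<theta> x)))"
      using smooth_on_compose[OF _ inv] by blast
    moreover have "smooth_on U (\<lambda>x. x + (- (2 * pi * of_int n)))"
      by (intro smooth_on_add smooth_on_ident smooth_on_const)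
    ultimately show "smooth_on U (\<lambda>x. C (\<phi> (inv \<theta> (x + (- (2 * pi * of_int n))))))"
      by (rule smooth_on_compose) (auto simp: U_def)
    show "C (\<phi> (inv \<theta> (x + (- (2 * pi * of_int n))))) = polar x" if "x \<in> U" for x
    proof -
      have "x - 2 * pi * of_int n \<in> range \<theta>" using that by (simp add: U_def)
      then have "C (\<phi> (inv \<theta> (x + (- (2 * pi * of_int n))))) = polar (x - 2 * pi * of_int n)"
        by (simp add: \<theta>(2) f_inv_into_f)
      also have "\<dots> = polar x" using polar_periodic_int[of "x - 2 * pi * of_int n" n] by simp
      finally show ?thesis .
    qed
  qed
  ultimately show "\<exists>U. open U \<and> s \<in> U \<and> smooth_on U polar" by blast
qed

lemmas smooth_polar' = smooth_on_UNIV_vector_derivative(1)[OF smooth_polar]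
  and polar_derivative = smooth_on_UNIV_vector_derivative(2)[OF smooth_polar]

lemmas smooth_polar'' = smooth_on_UNIV_vector_derivative(1)[OF smooth_polar']
  and polar'_derivative = smooth_on_UNIV_vector_derivative(2)[OF smooth_polar']

text \<open>
  The polar curve is a positive multiple \<open>\<rho>\<close> of \<open>cis\<close>; only the rotation of \<open>cis\<close>, not the change of
  \<open>\<rho>\<close>, contributes to the cross product.
\<close>
lemma cross_polar_polar': "cross (polar s) (polar' s) = (cmod (polar s))\<^sup>2"
proof -
  \<comment> \<open>\<open>polar s * cis (- s)\<close> is the real factor \<open>\<rho>\<close>, whose derivative is real as well.\<close>
  have "((\<lambda>s. cis (- s)) has_vector_derivative - \<i> * cis (- s)) (at s)"
    unfolding cis_conv_exp of_real_minus
    by (rule has_vector_derivative_real_field) (auto intro!: derivative_eq_intros)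
  from has_vector_derivative_mult[OF polar_derivative this]
  have "Im (polar s * (- \<i> * cis (- s)) + polar' s * cis (- s)) = 0"
    by (rule vector_derivative_real_valued) (simp add: polar_def cis_mult)
  then have "Im ((polar s * (- \<i> * cis (- s)) + polar' s * cis (- s)) /\<^sub>R norm (L (cis s))) = 0"
    by simp
  also have "(polar s * (- \<i> * cis (- s)) + polar' s * cis (- s)) /\<^sub>R norm (L (cis s))
      = cnj (polar s) * polar' s - \<i> * (polar s * cnj (polar s))"
    by (simp add: polar_def cis_cnj algebra_simps)
  finally show ?thesis unfolding cross_def complex_norm_square[symmetric] by simp
qed

lemma polar'_nonzero: "polar' s \<noteq> 0"
proof
  assume "polar' s = 0"
  then show False using cross_polar_polar'[of s] by (simp add: cross_def)
qed

lemma birkhoff_orth_polar: "L (polar s) \<stileturn>\<^sub>B L (polar' s)"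
  by (rule birkhoff_orth_tangent[where f = "\<lambda>s. L (polar s)", OF norm_L_polar
      bounded_linear.has_vector_derivative[OF bounded_linear_L polar_derivative]])

text \<open>
  Birkhoff orthogonality to \<open>w\<close> says that the functional \<open>\<omega> _ w\<close>, which vanishes on \<open>w\<close>, attains its
  maximal absolute value on the unit circle at \<open>L (polar s)\<close>. As the circle is smooth, the derivative
  of this functional along the circle vanishes there.
\<close>
lemma birkhoff_orth_polar_unique:
  assumes "L (polar s) \<stileturn>\<^sub>B w"
  shows "cross (polar' s) (C w) = 0"
proof (cases "w = 0")
  case False
  have max: "\<bar>cross (polar t) (C w)\<bar> \<le> \<bar>cross (polar s) (C w)\<bar>" for t
  proof (rule ccontr)
    assume "\<not> ?thesis"
    then have less: "\<bar>cross (polar s) (C w)\<bar> < \<bar>cross (polar t) (C w)\<bar>" by simp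
    define c where "c = cross (polar s) (C w) / cross (polar t) (C w)"
    have "\<bar>c\<bar> < 1" using less by (simp add: c_def divide_less_eq)
    have "cross (C w) (c *\<^sub>R polar t + (- 1) *\<^sub>R polar s) = 0"
      using less unfolding cross_simps by (simp add: c_def cross_commute[of "C w"])
    moreover have "C w \<noteq> 0" using False by simp
    ultimately obtain r where "c *\<^sub>R polar t + (- 1) *\<^sub>R polar s = r *\<^sub>R C w"
      by (rule cross_eq_0_parallel)
    then have "c *\<^sub>R polar t = polar s + r *\<^sub>R C w" by (simp add: algebra_simps)
    \<comment> \<open>The line in direction \<open>w\<close> would enter the open unit ball at \<open>c *\<^sub>R L (polar t)\<close>.\<close>
    from arg_cong[OF this, of L] have "L (polar s) + r *\<^sub>R w = c *\<^sub>R L (polar t)"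
      by (simp add: L_simps)
    then have "norm (L (polar s) + r *\<^sub>R w) < 1" using \<open>\<bar>c\<bar> < 1\<close> by simp
    with assms show False by (auto simp: birkhoff_orth_def not_le[symmetric])
  qed
  have "bounded_linear (\<lambda>z. cross z (C w))"
    unfolding cross_def
    by (intro bounded_linear_compose[OF bounded_linear_Im]
        bounded_linear_compose[OF bounded_linear_mult_left] bounded_linear_cnj)
  from bounded_linear.has_vector_derivative[OF this polar_derivative]
  have der: "((\<lambda>t. cross (polar t) (C w)) has_real_derivative cross (polar' s) (C w)) (at s)"
    by (simp add: has_real_derivative_iff_has_vector_derivative)
  show ?thesis
  proof (cases "cross (polar s) (C w) \<ge> 0")
    case True
    have "cross (polar t) (C w) \<le> cross (polar s) (C w)" for t using max[of t] True by linarith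
    then show ?thesis using DERIV_local_max[OF der zero_less_one] by blast
  next
    case False
    have "cross (polar s) (C w) \<le> cross (polar t) (C w)" for t using max[of t] False by linarith
    then show ?thesis using DERIV_local_min[OF der zero_less_one] by blast
  qed
qed (simp add: C_simps cross_def)

text \<open>
  Nonflatness does not depend on the parametrization: for \<open>\<phi> = polar \<circ> \<theta>\<close> in coordinates,
  \<open>cross \<phi>' \<phi>'' = \<theta>'\<^sup>3 * cross polar' polar''\<close>.
\<close>
lemma cross_polar'_polar'':
  assumes "nonflat_unit_circle \<omega>"
  shows "cross (polar' s) (polar'' s) \<noteq> 0"
proof -
  obtain \<phi> where \<phi>: "unit_circle_param \<phi>" and nonflat: "\<And>u. \<omega> (vector_derivative \<phi> (at u))
      (vector_derivative (\<lambda>s. vector_derivative \<phi> (at s)) (at u)) \<noteq> 0"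
    using assms unfolding nonflat_unit_circle_def by blast
  obtain \<theta> where \<theta>: "smooth_on UNIV \<theta>" "\<And>u. \<phi> u = L (polar (\<theta> u))"
    by (rule circle_param_angle[OF \<phi>]) (rule that)
  define \<theta>' where "\<theta>' u = vector_derivative \<theta> (at u)" for u
  define \<theta>'' where "\<theta>'' u = vector_derivative \<theta>' (at u)" for u
  note smooth_\<theta>' = smooth_on_UNIV_vector_derivative(1)[OF \<theta>(1), folded \<theta>'_def]
  note \<theta>_der = smooth_on_UNIV_vector_derivative(2)[OF \<theta>(1), folded \<theta>'_def]
  note \<theta>'_der = smooth_on_UNIV_vector_derivative(2)[OF smooth_\<theta>', folded \<theta>''_def]
  have 1: "vector_derivative \<phi> (at u) = L (\<theta>' u *\<^sub>R polar' (\<theta> u))" for u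
    using bounded_linear.has_vector_derivative[OF bounded_linear_L
        has_vector_derivative_compose_real[OF polar_derivative \<theta>_der]]
    unfolding \<theta>(2)[symmetric] by (rule vector_derivative_at)
  have 2: "vector_derivative (\<lambda>s. vector_derivative \<phi> (at s)) (at u)
      = L (\<theta>' u *\<^sub>R \<theta>' u *\<^sub>R polar'' (\<theta> u) + \<theta>'' u *\<^sub>R polar' (\<theta> u))" for u
    unfolding 1
    by (intro vector_derivative_at bounded_linear.has_vector_derivative[OF bounded_linear_L]
        has_vector_derivative_scaleR has_vector_derivative_compose_real polar'_derivative \<theta>_der)
       (simp add: has_real_derivative_iff_has_vector_derivative \<theta>'_der)
  obtain u where "\<phi> u = L (polar s)"
    using \<phi> norm_L_polar[of s] unfolding unit_circle_param_def by (metis imageE mem_sphere_0)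
  then have "polar s = polar (\<theta> u)" using \<theta>(2) by (metis C_L)
  then obtain n :: int where n: "s = \<theta> u + 2 * pi * of_int n" using polar_eq_imp by blast
  have p': "polar' (x + 2 * pi * of_int n) = polar' x" for x
    by (rule vector_derivative_periodic[OF smooth_polar polar_periodic_int])
  have p'': "polar'' (x + 2 * pi * of_int n) = polar'' x" for x
    by (rule vector_derivative_periodic[OF smooth_polar' p'])
  show ?thesis
    using nonflat[of u] unfolding 2 unfolding 1 n p' p'' by (auto simp: omega_L)
qed

text \<open>
  The map \<open>B\<close> is the inverse of the tangent angle \<open>\<beta>\<close> of the polar curve, that is, the inverse of the
  Birkhoff map \<open>b\<close> expressed in polar angles. Nonflatness gives \<open>\<beta>' \<noteq> 0\<close>. Since \<open>\<beta>'\<close> is periodic, \<open>\<beta>\<close>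
  gains a constant \<open>c\<close> over each period; \<open>c\<close> is nonzero because \<open>\<beta>\<close> is injective, so \<open>\<beta>\<close> is a
  diffeomorphism of the whole line.
\<close>
lemma tangent_direction_section:
  assumes "nonflat_unit_circle \<omega>"
  obtains B where "smooth_on UNIV B" "\<And>s. \<exists>r. r \<noteq> 0 \<and> cis s = r *\<^sub>R polar' (B s)"
proof -
  obtain Q where Q: "smooth_on UNIV Q" "\<And>s. polar' s = exp (Q s)"
    and Q_der: "\<And>s. (Q has_vector_derivative polar'' s / polar' s) (at s)"
    using smooth_logarithm[OF is_interval_univ smooth_polar' polar'_nonzero] polar'_derivative
    by (metis UNIV_I trivial_limit_at)
  define \<beta> where "\<beta> s = Im (Q s)" for s
  define \<beta>' where "\<beta>' s = Im (polar'' s / polar' s)" for s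
  have smooth: "smooth_on UNIV \<beta>"
    unfolding \<beta>_def by (intro smooth_on_bounded_linear[OF bounded_linear_Im] Q)
  have der: "(\<beta> has_vector_derivative \<beta>' s) (at s)" for s
    unfolding \<beta>_def \<beta>'_def
    by (intro bounded_linear.has_vector_derivative[OF bounded_linear_Im] Q_der)
  have "\<beta>' s \<noteq> 0" for s
    using cross_polar'_polar''[OF assms] polar'_nonzero[of s] by (simp add: \<beta>'_def Im_divide_cross)
  then have nz: "vector_derivative \<beta> (at s) \<noteq> 0" for s
    using der by (metis vector_derivative_at)
  have DERIV: "(\<beta> has_real_derivative vector_derivative \<beta> (at s)) (at s)" for s
    using smooth_on_UNIV_vector_derivative(2)[OF smooth]
    by (simp add: has_real_derivative_iff_has_vector_derivative)
  have inj: "inj \<beta>" by (rule nonzero_derivative_inverse(1)[OF DERIV nz])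
  have p': "polar' (x + 2 * pi) = polar' x" for x
    by (rule vector_derivative_periodic[OF smooth_polar polar_periodic])
  have p'': "polar'' (x + 2 * pi) = polar'' x" for x
    by (rule vector_derivative_periodic[OF smooth_polar' p'])
  have "((\<lambda>s. \<beta> (s + 2 * pi) - \<beta> s) has_vector_derivative 0) (at s)" for s
  proof -
    have "((\<lambda>s. s + 2 * pi) has_vector_derivative 1) (at s)"
      by (auto intro!: derivative_eq_intros)
    from has_vector_derivative_diff[OF has_vector_derivative_compose_real[OF der this] der]
    show ?thesis by (simp add: \<beta>'_def p' p'')
  qed
  then have "((\<lambda>s. \<beta> (s + 2 * pi) - \<beta> s) has_derivative (\<lambda>h. 0)) (at s within UNIV)" for s
    by (simp add: has_vector_derivative_def)
  from has_derivative_zero_constant[OF convex_UNIV this]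
  obtain c where c: "\<And>s. \<beta> (s + 2 * pi) - \<beta> s = c" by auto
  have "c \<noteq> 0"
    using c[of 0] injD[OF inj, of "0 + 2 * pi" 0] by auto
  have shift: "\<beta> (2 * pi * of_int n) = \<beta> 0 + of_int n * c" for n :: int
  proof (induction n rule: int_induct[where k = 0])
    case (step1 i)
    then show ?case using c[of "2 * pi * of_int i"] by (simp add: algebra_simps)
  next
    case (step2 i)
    then show ?case using c[of "2 * pi * of_int (i - 1)"] by (simp add: algebra_simps)
  qed simp
  have range: "range \<beta> = UNIV"
  proof (intro equalityI subset_UNIV subsetI)
    fix y
    define q where "q = (y - \<beta> 0) / c"
    \<comment> \<open>Over the \<open>n\<close>-th period \<open>\<beta>\<close> passes from \<open>\<beta> 0 + n c\<close> to \<open>\<beta> 0 + (n + 1) c\<close>, and \<open>y\<close> lies in between.\<close>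
    define n where "n = \<lfloor>q\<rfloor>"
    define f where "f = q - of_int n"
    have f: "0 \<le> f" "f \<le> 1" unfolding f_def n_def by linarith+
    have conv: "convex (range \<beta>)"
      using connected_continuous_image[OF smooth_on_imp_continuous_on[OF smooth] connected_UNIV]
      by (rule is_interval_convex_1[THEN iffD1, OF is_interval_connected_1[THEN iffD2]])
    have "(1 - f) *\<^sub>R \<beta> (2 * pi * of_int n) + f *\<^sub>R \<beta> (2 * pi * of_int (n + 1)) \<in> range \<beta>"
      by (rule convexD[OF conv rangeI rangeI]) (use f in auto)
    also have "(1 - f) *\<^sub>R \<beta> (2 * pi * of_int n) + f *\<^sub>R \<beta> (2 * pi * of_int (n + 1)) = y"
      unfolding shift f_def using \<open>c \<noteq> 0\<close> by (simp add: q_def field_simps)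
    finally show "y \<in> range \<beta>" .
  qed
  show ?thesis
  proof (rule that)
    show "smooth_on UNIV (inv \<beta>)" using smooth_on_inv[OF smooth nz] by (simp add: range)
    show "\<exists>r. r \<noteq> 0 \<and> cis s = r *\<^sub>R polar' (inv \<beta> s)" for s
    proof -
      have "polar' (inv \<beta> s) = exp (Re (Q (inv \<beta> s))) *\<^sub>R cis (\<beta> (inv \<beta> s))"
        unfolding Q(2) \<beta>_def by (simp add: exp_eq_polar scaleR_conv_of_real)
      also have "\<beta> (inv \<beta> s) = s" by (simp add: f_inv_into_f range)
      finally show ?thesis
        by (intro exI[of _ "exp (- Re (Q (inv \<beta> s)))"]) (simp add: exp_minus)
    qed
  qed
qed

section \<open>Pedal curves\<close>

lemma birkhoff_vec_polar:
  "birkhoff_vec \<omega> (L (polar s)) = L (polar' s) /\<^sub>R norm (L (polar' s))"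
  unfolding birkhoff_vec_def
proof (rule the_equality)
  have T: "L (polar' s) \<noteq> 0" by (simp add: polar'_nonzero)
  let ?w = "L (polar' s) /\<^sub>R norm (L (polar' s))"
  have "\<omega> (L (polar s)) ?w > 0"
    using T by (simp flip: L_simps(3) add: omega_L cross_polar_polar')
  then show "norm ?w = 1 \<and> L (polar s) \<stileturn>\<^sub>B ?w \<and> \<omega> (L (polar s)) ?w > 0"
    using T by (simp add: birkhoff_orth_scaleR_right birkhoff_orth_polar)
  fix w assume w: "norm w = 1 \<and> L (polar s) \<stileturn>\<^sub>B w \<and> \<omega> (L (polar s)) w > 0"
  then obtain c where "C w = c *\<^sub>R polar' s"
    using birkhoff_orth_polar_unique[of s w] polar'_nonzero cross_eq_0_parallel by blast
  from arg_cong[OF this, of L] have c: "w = c *\<^sub>R L (polar' s)" by (simp add: L_simps)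
  have "c > 0"
    using w by (simp add: c flip: L_simps(3)) (simp add: omega_L cross_polar_polar' zero_less_mult_iff)
  then have "c * norm (L (polar' s)) = 1" using w by (simp add: c)
  then have "c = inverse (norm (L (polar' s)))" using T by (simp add: field_simps)
  then show "w = ?w" by (simp add: c)
qed

text \<open>
  The point \<open>p + x *\<^sub>R \<eta> t\<close> lies on the tangent line and satisfies the orthogonality condition; left
  uniqueness of Birkhoff orthogonality, which rests on strict convexity, excludes any other point.
\<close>
lemma pedal_curve_polar:
  assumes \<eta>: "\<eta> t = L (polar s)" and foot: "C (\<gamma> t - p) = x *\<^sub>R polar s + y *\<^sub>R polar' s"
  shows "pedal_curve \<omega> \<gamma> \<eta> p t = p + x *\<^sub>R \<eta> t"
  unfolding pedal_curve_def
proof (rule the_equality)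
  let ?\<xi> = "birkhoff_vec \<omega> (\<eta> t)"
  define m where "m = norm (L (polar' s))"
  have m: "m > 0" by (simp add: m_def polar'_nonzero)
  have \<xi>: "?\<xi> = L (polar' s) /\<^sub>R m" by (simp add: \<eta> birkhoff_vec_polar m_def)
  have "\<gamma> t - p = x *\<^sub>R L (polar s) + y *\<^sub>R L (polar' s)"
    using arg_cong[OF foot, of L] by (simp add: L_simps)
  then have \<gamma>: "\<gamma> t = p + x *\<^sub>R \<eta> t + (y * m) *\<^sub>R ?\<xi>"
    unfolding \<xi> using m by (simp add: \<eta> algebra_simps)
  have orth: "x *\<^sub>R \<eta> t \<stileturn>\<^sub>B ?\<xi>"
    unfolding \<eta> birkhoff_vec_polar
    by (intro birkhoff_orth_scaleR_left birkhoff_orth_scaleR_right birkhoff_orth_polar)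
  show "(\<exists>s. p + x *\<^sub>R \<eta> t = \<gamma> t + s *\<^sub>R ?\<xi>) \<and> p + x *\<^sub>R \<eta> t - p \<stileturn>\<^sub>B ?\<xi>"
    using orth by (auto simp: \<gamma> intro!: exI[of _ "- (y * m)"])
  fix q assume "(\<exists>s. q = \<gamma> t + s *\<^sub>R ?\<xi>) \<and> q - p \<stileturn>\<^sub>B ?\<xi>"
  then obtain r where r: "q = \<gamma> t + r *\<^sub>R ?\<xi>" "q - p \<stileturn>\<^sub>B ?\<xi>" by blast
  have "q - p = x *\<^sub>R \<eta> t + (y * m + r) *\<^sub>R ?\<xi>" by (simp add: r \<gamma> algebra_simps)
  moreover have "?\<xi> \<noteq> 0" using m by (simp add: \<xi> polar'_nonzero)
  ultimately have "y * m + r = 0" using birkhoff_orth_left_unique orth r(2) by metis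
  then show "q = p + x *\<^sub>R \<eta> t"
    using \<open>q - p = x *\<^sub>R \<eta> t + (y * m + r) *\<^sub>R ?\<xi>\<close> by (simp add: algebra_simps)
qed

text \<open>
  The normal is the point of the unit circle whose tangent has the polar angle of \<open>W\<close>. The angle of \<open>W\<close>
  and the inverse tangent angle \<open>B\<close> being smooth and globally defined, the normal is as well.
\<close>
lemma ex_smooth_normal:
  assumes "nonflat_unit_circle \<omega>" and I: "is_interval I"
    and W: "smooth_on I W" "\<And>t. t \<in> I \<Longrightarrow> W t \<noteq> 0"
  obtains \<nu> where "smooth_on I \<nu>" "\<And>t. norm (\<nu> t) = 1" "\<And>t. t \<in> I \<Longrightarrow> \<nu> t \<stileturn>\<^sub>B L (W t)"
proof -
  obtain B where B: "smooth_on UNIV B" "\<And>s. \<exists>r. r \<noteq> 0 \<and> cis s = r *\<^sub>R polar' (B s)"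
    using tangent_direction_section[OF assms(1)] by blast
  obtain q where q: "smooth_on I q" "\<And>t. t \<in> I \<Longrightarrow> W t = exp (q t)"
    by (rule smooth_logarithm[OF I W], assumption) (rule that)
  show ?thesis
  proof (rule that)
    have "smooth_on I (\<lambda>t. Im (q t))"
      by (intro smooth_on_bounded_linear[OF bounded_linear_Im] q)
    then have "smooth_on I (\<lambda>t. B (Im (q t)))"
      using smooth_on_compose[OF B(1)] by blast
    then show "smooth_on I (\<lambda>t. L (polar (B (Im (q t)))))"
      using smooth_on_bounded_linear[OF bounded_linear_L smooth_on_compose[OF smooth_polar]] by blast
    show "L (polar (B (Im (q t)))) \<stileturn>\<^sub>B L (W t)" if "t \<in> I" for t
    proof -
      obtain r where "cis (Im (q t)) = r *\<^sub>R polar' (B (Im (q t)))" using B(2) by blast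
      then have "W t = (exp (Re (q t)) * r) *\<^sub>R polar' (B (Im (q t)))"
        by (simp add: q(2)[OF that] exp_eq_polar scaleR_conv_of_real)
      then show ?thesis
        by (simp add: L_simps birkhoff_orth_scaleR_right birkhoff_orth_polar)
    qed
  qed simp
qed

text \<open>
  Along the Legendre curve write \<open>\<gamma> - p = x E + y T\<close>, where \<open>E\<close> and \<open>T\<close> are the position and tangent
  vector on the unit circle at the angle \<open>\<theta>\<close> of \<open>\<eta>\<close>. Differentiating and using that \<open>\<gamma>'\<close> is parallel
  to \<open>T\<close> yields \<open>x' = \<theta>' y k / d\<close>. Hence the pedal curve \<open>p + x E\<close> has velocity \<open>\<theta>' W\<close> with
  \<open>W = x T + (y k / d) E\<close>, and \<open>W\<close> vanishes only where \<open>x = y = 0\<close>.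
\<close>
theorem pedal_curve_frontal_and_singularities:
  assumes nonflat: "nonflat_unit_circle \<omega>"
    and I: "is_interval I" "interior I \<noteq> {}"
    and legendre: "legendre_curve I \<gamma> \<eta>"
    and curvature: "legendre_curvature \<omega> I \<gamma> \<eta> \<alpha> \<kappa>"
    and p: "p \<notin> \<gamma> ` I"
  shows "frontal I (pedal_curve \<omega> \<gamma> \<eta> p) \<and>
         (\<forall>t\<in>I. vector_derivative (pedal_curve \<omega> \<gamma> \<eta> p) (at t within I) = 0 \<longleftrightarrow> \<kappa> t = 0)"
proof -
  let ?P = "pedal_curve \<omega> \<gamma> \<eta> p"
  note nontrivial = at_within_interval_nontrivial[OF I]
  have \<gamma>: "smooth_on I \<gamma>" and \<eta>: "smooth_on I \<eta>" "\<And>t. t \<in> I \<Longrightarrow> norm (\<eta> t) = 1"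
    using legendre by (auto simp: legendre_curve_def)
  obtain \<theta> where \<theta>: "smooth_on I \<theta>" "\<And>t. t \<in> I \<Longrightarrow> \<eta> t = L (polar (\<theta> t))"
    by (rule unit_curve_angle[OF I(1) \<eta>], assumption) (rule that)
  obtain \<theta>' where \<theta>': "\<And>t. t \<in> I \<Longrightarrow> (\<theta> has_vector_derivative \<theta>' t) (at t within I)"
    using smooth_onE[OF \<theta>(1)] by blast
  define E T T' where "E t = polar (\<theta> t)" and "T t = polar' (\<theta> t)" and "T' t = polar'' (\<theta> t)" for t
  define G where "G t = C (\<gamma> t - p)" for t
  have smooth: "smooth_on I E" "smooth_on I T" "smooth_on I T'"
    unfolding E_def T_def T'_def using smooth_polar smooth_polar' smooth_polar'' \<theta>(1)
    by (auto intro: smooth_on_compose)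
  have E: "(E has_vector_derivative \<theta>' t *\<^sub>R T t) (at t within I)"
    and T: "(T has_vector_derivative \<theta>' t *\<^sub>R T' t) (at t within I)" if "t \<in> I" for t
    unfolding E_def T_def T'_def
    using that by (auto intro: has_vector_derivative_compose_real polar_derivative polar'_derivative \<theta>')
  define d k where "d t = cross (E t) (T t)" and "k t = cross (T t) (T' t)" for t
  have d: "d t > 0" and k: "k t \<noteq> 0" and T_nz: "T t \<noteq> 0" for t
    by (simp_all add: d_def k_def E_def T_def T'_def cross_polar_polar' cross_polar'_polar''[OF nonflat]
        polar'_nonzero)
  have d_nz: "d t \<noteq> 0" for t using d[of t] by simp
  define x y where "x t = cross (G t) (T t) / d t" and "y t = cross (E t) (G t) / d t" for t
  have G: "G t = x t *\<^sub>R E t + y t *\<^sub>R T t" for t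
  proof -
    have "d t *\<^sub>R G t = d t *\<^sub>R (x t *\<^sub>R E t + y t *\<^sub>R T t)"
      using cross_expansion[of "E t" "T t" "G t"] d_nz
      by (simp add: scaleR_add_right x_def y_def d_def)
    then show ?thesis using d_nz by simp
  qed
  have "smooth_on I (\<lambda>t. C (\<gamma> t) + - C p)"
    by (intro smooth_on_add smooth_on_const smooth_on_bounded_linear[OF bounded_linear_C \<gamma>])
  then have smooth_G: "smooth_on I G"
    unfolding G_def by (simp add: C_simps)
  have smooth_dk: "smooth_on I d" "smooth_on I k"
    unfolding d_def k_def by (intro smooth_on_cross smooth)+
  have smooth_xy: "smooth_on I x" "smooth_on I y"
    unfolding x_def y_def by (intro smooth_on_divide smooth_on_cross smooth smooth_G smooth_dk d_nz)+
  obtain x' where x': "\<And>t. t \<in> I \<Longrightarrow> (x has_vector_derivative x' t) (at t within I)"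
    using smooth_onE[OF smooth_xy(1)] by blast
  obtain y' where y': "\<And>t. t \<in> I \<Longrightarrow> (y has_vector_derivative y' t) (at t within I)"
    using smooth_onE[OF smooth_xy(2)] by blast
  have pedal: "?P t = L (x t *\<^sub>R E t) + p" if "t \<in> I" for t
    using pedal_curve_polar[of \<eta> t "\<theta> t" \<gamma> p "x t" "y t"] \<theta>(2)[OF that] G[of t]
    by (simp add: E_def T_def G_def L_simps)
  define \<mu> where "\<mu> t = inverse (norm (L (T t)))" for t
  have \<mu>: "\<mu> t > 0" for t by (simp add: \<mu>_def T_nz)
  have \<xi>: "birkhoff_vec \<omega> (\<eta> t) = L (\<mu> t *\<^sub>R T t)" if "t \<in> I" for t
    by (simp add: \<theta>(2)[OF that] birkhoff_vec_polar \<mu>_def T_def L_simps)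
  have \<gamma>': "(\<gamma> has_vector_derivative L ((\<alpha> t * \<mu> t) *\<^sub>R T t)) (at t within I)"
    and \<eta>': "(\<eta> has_vector_derivative L ((\<kappa> t * \<mu> t) *\<^sub>R T t)) (at t within I)"
    if t: "t \<in> I" for t
  proof -
    obtain g e where "(\<gamma> has_vector_derivative g) (at t within I)"
        "(\<eta> has_vector_derivative e) (at t within I)"
      using \<gamma> \<eta>(1) t smooth_onE by metis
    moreover from this have "g = \<alpha> t *\<^sub>R birkhoff_vec \<omega> (\<eta> t)" "e = \<kappa> t *\<^sub>R birkhoff_vec \<omega> (\<eta> t)"
      using curvature t vector_derivative_within[OF nontrivial[OF t]]
      unfolding legendre_curvature_def by metis+
    ultimately show "(\<gamma> has_vector_derivative L ((\<alpha> t * \<mu> t) *\<^sub>R T t)) (at t within I)"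
      "(\<eta> has_vector_derivative L ((\<kappa> t * \<mu> t) *\<^sub>R T t)) (at t within I)"
      using \<xi>[OF t] by (simp_all add: L_simps)
  qed
  have \<theta>'_eq: "\<theta>' t = \<kappa> t * \<mu> t" if t: "t \<in> I" for t
  proof -
    have "(E has_vector_derivative (\<kappa> t * \<mu> t) *\<^sub>R T t) (at t within I)"
      using has_vector_derivative_transform[OF t _ bounded_linear.has_vector_derivative[OF
            bounded_linear_C \<eta>'[OF t]], of E] \<theta>(2) by (simp add: E_def)
    from vector_derivative_unique_within[OF nontrivial[OF t] E[OF t] this] show ?thesis
      using T_nz by simp
  qed
  have x'_eq: "x' t = y t * \<theta>' t * k t / d t" if t: "t \<in> I" for t
  proof -
    have "(G has_vector_derivative (\<alpha> t * \<mu> t) *\<^sub>R T t) (at t within I)"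
      using bounded_linear.has_vector_derivative[OF bounded_linear_C
          has_vector_derivative_diff_const[THEN iffD2, OF \<gamma>'[OF t], of p]]
      unfolding G_def by simp
    moreover have "(G has_vector_derivative (x t *\<^sub>R \<theta>' t *\<^sub>R T t + x' t *\<^sub>R E t)
        + (y t *\<^sub>R \<theta>' t *\<^sub>R T' t + y' t *\<^sub>R T t)) (at t within I)"
      unfolding G[abs_def]
      using x'[OF t] y'[OF t] E[OF t] T[OF t]
      by (intro has_vector_derivative_add has_vector_derivative_scaleR)
         (simp_all add: has_real_derivative_iff_has_vector_derivative)
    ultimately have "(\<alpha> t * \<mu> t) *\<^sub>R T t = (x t *\<^sub>R \<theta>' t *\<^sub>R T t + x' t *\<^sub>R E t)
        + (y t *\<^sub>R \<theta>' t *\<^sub>R T' t + y' t *\<^sub>R T t)"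
      by (rule vector_derivative_unique_within[OF nontrivial[OF t]])
    \<comment> \<open>Pairing with \<open>T t\<close> removes the terms parallel to \<open>T t\<close>, the unknown \<open>y'\<close> among them.\<close>
    from arg_cong[OF this, of "cross (T t)"] have "x' t * d t = y t * \<theta>' t * k t"
      by (simp add: k_def d_def cross_commute[of "T t" "E t"])
    then show ?thesis using d_nz by (simp add: field_simps)
  qed
  define W where "W t = x t *\<^sub>R T t + (y t * k t / d t) *\<^sub>R E t" for t
  have P': "(?P has_vector_derivative \<theta>' t *\<^sub>R L (W t)) (at t within I)" if t: "t \<in> I" for t
  proof -
    have "((\<lambda>t. x t *\<^sub>R E t) has_vector_derivative x t *\<^sub>R \<theta>' t *\<^sub>R T t + x' t *\<^sub>R E t) (at t within I)"
      using x'[OF t] E[OF t] by (intro has_vector_derivative_scaleR)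
        (simp_all add: has_real_derivative_iff_has_vector_derivative)
    also have "x t *\<^sub>R \<theta>' t *\<^sub>R T t + x' t *\<^sub>R E t = \<theta>' t *\<^sub>R W t"
      by (simp add: x'_eq[OF t] W_def scaleR_add_right mult.commute mult.left_commute)
    finally have "((\<lambda>t. L (x t *\<^sub>R E t) + p) has_vector_derivative L (\<theta>' t *\<^sub>R W t)) (at t within I)"
      by (intro has_vector_derivative_add_const[THEN iffD2]
          bounded_linear.has_vector_derivative[OF bounded_linear_L])
    from has_vector_derivative_transform[OF t pedal this] show ?thesis by (simp add: L_simps)
  qed
  note P'_eq = vector_derivative_within[OF nontrivial P']
  have W: "W t \<noteq> 0" if "t \<in> I" for t
  proof
    assume "W t = 0"
    then have "cross (E t) (W t) = 0" "cross (W t) (T t) = 0" by (simp_all add: cross_def)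
    then have "x t = 0" "y t = 0"
      using d_nz k by (simp_all add: W_def d_def)
    then have "G t = 0" using G by simp
    then have "\<gamma> t = p" by (simp add: G_def)
    then show False using p that by blast
  qed
  have "smooth_on I W"
    unfolding W_def
    by (intro smooth_on_add smooth_on_scaleR smooth_on_divide smooth_on_mult smooth smooth_xy
        smooth_dk d_nz)
  from ex_smooth_normal[OF nonflat I(1) this W]
  obtain \<nu> where \<nu>: "smooth_on I \<nu>" "\<And>t. norm (\<nu> t) = 1" "\<And>t. t \<in> I \<Longrightarrow> \<nu> t \<stileturn>\<^sub>B L (W t)"
    by blast
  have "smooth_on I (\<lambda>t. L (x t *\<^sub>R E t + C p))"
    by (intro smooth_on_bounded_linear[OF bounded_linear_L] smooth_on_add smooth_on_scaleR
        smooth_xy smooth smooth_on_const)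
  then have "smooth_on I ?P"
    by (rule smooth_on_cong[rotated]) (simp add: pedal L_simps)
  with \<nu> have "legendre_curve I ?P \<nu>"
    by (auto simp: legendre_curve_def P'_eq birkhoff_orth_scaleR_right)
  then show ?thesis
    using W by (auto simp: frontal_def P'_eq \<theta>'_eq less_imp_neq[OF \<mu>, symmetric])
qed

end

theorem theorem8p1:
  fixes \<omega> :: "'a::real_normed_vector \<Rightarrow> 'a \<Rightarrow> real"
    and \<gamma> \<eta> :: "real \<Rightarrow> 'a"
    and \<alpha> \<kappa> :: "real \<Rightarrow> real"
    and I :: "real set"
    and p :: 'a
  assumes "normed_plane \<omega>"
    and "nonflat_unit_circle \<omega>"
    and "is_interval I" and "interior I \<noteq> {}"
    and "legendre_curve I \<gamma> \<eta>"
    and "legendre_curvature \<omega> I \<gamma> \<eta> \<alpha> \<kappa>"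
    and "p \<notin> \<gamma> ` I"
  shows "frontal I (pedal_curve \<omega> \<gamma> \<eta> p) \<and>
         (\<forall>t\<in>I. vector_derivative (pedal_curve \<omega> \<gamma> \<eta> p) (at t within I) = 0 \<longleftrightarrow> \<kappa> t = 0)"
proof -
  interpret normed_plane \<omega> by fact
  obtain L C where "plane_coordinates \<omega> L C" using ex_plane_coordinates by blast
  from plane_coordinates.pedal_curve_frontal_and_singularities[OF this assms(2-7)] show ?thesis .
qed

end
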